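(* Let $q\ge 2$ and $m\ge 1$ be integers and assume that a quantum error-correcting code $\mathcal{C}=(\!(n,K,d)\!)_{q^m}$ exists. Then a quantum error-correcting code $\mathcal{C}'=(\!(mn,K,d')\!)_q$ with $d'\ge d$ exists as well.
   Context: For an integer $Q\ge 2$, the weight $\mathrm{wgt}(E)$ of a linear operator $E$ on $(\mathbb{C}^Q)^{\otimes n}$ is the number of tensor factors (subsystems) on which it acts non-trivially, i.e. the smallest size of a set $T\subseteq\{1,\dots,n\}$ such that $E$ is the tensor product of the identity on the factors outside $T$ with some operator on the factors in $T$. A quantum error-correcting code $(\!(n,K,d)\!)_Q$ is a complex linear subspace $\mathcal{C}\subseteq(\mathbb{C}^Q)^{\otimes n}$ of dimension $K>1$ such that the Knill-Laflamme conditions hold for all pairs of linear operators $E_k,E_\ell$ on $(\mathbb{C}^Q)^{\otimes n}$ with $\mathrm{wgt}(E_k^\dagger E_\ell)<d$: for an orthonormal basis $\{|c_i\rangle\}$ of $\mathcal{C}$, one has $\langle c_i|E_k^\dagger E_\ell|c_j\rangle=0$ for $i\neq j$, and $\langle c_i|E_k^\dagger E_\ell|c_i\rangle=\langle c_j|E_k^\dagger E_\ell|c_j\rangle$ for all $i,j$. Equivalently, $P_{\mathcal{C}}E_k^\dagger E_\ell P_{\mathcal{C}}=\alpha_{k\ell}P_{\mathcal{C}}$ for some scalar $\alpha_{k\ell}$, where $P_{\mathcal{C}}$ is the orthogonal projection onto $\mathcal{C}$. (So the parameter $d$ is a lower bound on the true minimum distance.) *)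

theory Defs
  imports Complex_Main "HOL-Library.FuncSet" "HOL-Library.Function_Algebras"
begin

text \<open>
  For a set \<open>S\<close> of subsystems, the tensor product of copies of \<open>\<complex>\<^sup>Q\<close> indexed by \<open>S\<close> has the
  computational basis \<open>configs Q S\<close>. A vector is given by its coordinates in this basis, and a
  linear operator by its matrix in this basis. The \<open>n\<close>-fold tensor power has the subsystems
  \<open>{..<n}\<close>.
\<close>

type_synonym config = "nat \<Rightarrow> nat"
type_synonym state = "config \<Rightarrow> complex"
type_synonym oper = "config \<Rightarrow> config \<Rightarrow> complex"

definition configs :: "nat \<Rightarrow> nat set \<Rightarrow> config set" where
  "configs Q S = S \<rightarrow>\<^sub>E {..<Q}"

definition scale_state :: "complex \<Rightarrow> state \<Rightarrow> state" where
  "scale_state c \<psi> = (\<lambda>x. c * \<psi> x)"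

interpretation state: vector_space scale_state
  by unfold_locales (auto simp: scale_state_def fun_eq_iff algebra_simps)

definition state_space :: "nat \<Rightarrow> nat \<Rightarrow> state set" where
  "state_space Q n = {\<psi>. \<forall>x. x \<notin> configs Q {..<n} \<longrightarrow> \<psi> x = 0}"

definition braket :: "nat \<Rightarrow> nat \<Rightarrow> state \<Rightarrow> state \<Rightarrow> complex" where
  "braket Q n \<phi> \<psi> = (\<Sum>x\<in>configs Q {..<n}. cnj (\<phi> x) * \<psi> x)"

text \<open>Entries of an operator outside \<open>configs Q {..<n}\<close> are junk values that are never read.\<close>

definition op_apply :: "nat \<Rightarrow> nat \<Rightarrow> oper \<Rightarrow> state \<Rightarrow> state" where
  "op_apply Q n E \<psi> =
     (\<lambda>x. if x \<in> configs Q {..<n} then \<Sum>y\<in>configs Q {..<n}. E x y * \<psi> y else 0)"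

definition op_mult :: "nat \<Rightarrow> nat \<Rightarrow> oper \<Rightarrow> oper \<Rightarrow> oper" where
  "op_mult Q n E F = (\<lambda>x z. \<Sum>y\<in>configs Q {..<n}. E x y * F y z)"

definition op_adjoint :: "oper \<Rightarrow> oper" where
  "op_adjoint E = (\<lambda>x y. cnj (E y x))"

definition op_id :: oper where
  "op_id = (\<lambda>x y. if x = y then 1 else 0)"

text \<open>The tensor product of \<open>A\<close> on the subsystems \<open>T\<close> with \<open>B\<close> on the subsystems \<open>U\<close>
  (\<open>T\<close> and \<open>U\<close> disjoint).\<close>

definition op_tensor :: "nat set \<Rightarrow> nat set \<Rightarrow> oper \<Rightarrow> oper \<Rightarrow> oper" where
  "op_tensor T U A B =
     (\<lambda>x y. A (restrict x T) (restrict y T) * B (restrict x U) (restrict y U))"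

definition acts_within :: "nat \<Rightarrow> nat \<Rightarrow> nat set \<Rightarrow> oper \<Rightarrow> bool" where
  "acts_within Q n T E \<longleftrightarrow>
     (\<exists>A. \<forall>x\<in>configs Q {..<n}. \<forall>y\<in>configs Q {..<n}.
        E x y = op_tensor T ({..<n} - T) A op_id x y)"

definition wgt :: "nat \<Rightarrow> nat \<Rightarrow> oper \<Rightarrow> nat" where
  "wgt Q n E = (LEAST k. \<exists>T\<subseteq>{..<n}. card T = k \<and> acts_within Q n T E)"

definition orthonormal_basis :: "nat \<Rightarrow> nat \<Rightarrow> state set \<Rightarrow> state set \<Rightarrow> bool" where
  "orthonormal_basis Q n B C \<longleftrightarrow>
     state.span B = C \<and>
     (\<forall>b\<in>B. \<forall>c\<in>B. braket Q n b c = (if b = c then 1 else 0))"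

text \<open>The Knill-Laflamme conditions for the operator \<open>E\<close>, which is \<open>E\<^sub>k\<^sup>\<dagger> E\<^sub>l\<close> below.\<close>

definition knill_laflamme :: "nat \<Rightarrow> nat \<Rightarrow> state set \<Rightarrow> oper \<Rightarrow> bool" where
  "knill_laflamme Q n B E \<longleftrightarrow>
     (\<forall>b\<in>B. \<forall>c\<in>B. b \<noteq> c \<longrightarrow> braket Q n b (op_apply Q n E c) = 0) \<and>
     (\<forall>b\<in>B. \<forall>c\<in>B. braket Q n b (op_apply Q n E b) = braket Q n c (op_apply Q n E c))"

text \<open>\<open>is_qecc n K d Q C\<close>: the subspace \<open>C\<close> is an \<open>((n, K, d))\<close> code over \<open>Q\<close>-level systems;
  \<open>d\<close> is a lower bound on the true minimum distance.\<close>

definition is_qecc :: "nat \<Rightarrow> nat \<Rightarrow> nat \<Rightarrow> nat \<Rightarrow> state set \<Rightarrow> bool" where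
  "is_qecc n K d Q C \<longleftrightarrow>
     state.subspace C \<and> C \<subseteq> state_space Q n \<and> state.dim C = K \<and> K > 1 \<and>
     (\<exists>B. orthonormal_basis Q n B C \<and>
        (\<forall>Ek El. wgt Q n (op_mult Q n (op_adjoint Ek) El) < d \<longrightarrow>
           knill_laflamme Q n B (op_mult Q n (op_adjoint Ek) El)))"

end

(* Group the mn subsystems of dimension q into n consecutive blocks of m; each block is a single
   subsystem of dimension q^m. Relabelling the computational basis accordingly is a unitary, so it
   carries the code to one with the same dimension and the same Knill-Laflamme matrix elements.
   An operator acting on a set T of small subsystems acts, after regrouping, only on the blocks
   that meet T, of which there are at most card T: so regrouping does not increase weights. *)

theory Submission
  imports Defs
begin

section \<open>Supports of operators in the computational basis\<close>

lemma configs_eqI: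
  assumes "x \<in> configs Q S" "y \<in> configs Q S" "\<And>i. i \<in> S \<Longrightarrow> x i = y i"
  shows "x = y"
  using assms unfolding configs_def by (blast intro: PiE_ext)

lemma finite_configs: "finite S \<Longrightarrow> finite (configs Q S)"
  by (simp add: configs_def finite_PiE)

lemma card_configs: "finite S \<Longrightarrow> card (configs Q S) = Q ^ card S"
  by (simp add: configs_def card_funcsetE)

text \<open>Trades the existential over \<open>A\<close> for two conditions on matrix entries, which
  can be checked after a relabelling of the basis. The identity factor forces an entry to vanish
  unless \<open>x\<close> and \<open>y\<close> agree off \<open>T\<close>; the remaining entries can
  depend only on the coordinates in \<open>T\<close>.\<close>

lemma acts_within_iff:
  "acts_within Q n T E \<longleftrightarrow>
     (\<forall>x\<in>configs Q {..<n}. \<forall>y\<in>configs Q {..<n}. E x y \<noteq> 0 \<longrightarrow> (\<forall>i\<in>{..<n} - T. x i = y i)) \<and>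
     (\<forall>x\<in>configs Q {..<n}. \<forall>y\<in>configs Q {..<n}.
        \<forall>x'\<in>configs Q {..<n}. \<forall>y'\<in>configs Q {..<n}.
          (\<forall>i\<in>T. x i = x' i \<and> y i = y' i) \<longrightarrow> (\<forall>i\<in>{..<n} - T. x i = y i \<and> x' i = y' i) \<longrightarrow>
          E x y = E x' y')"
  (is "_ \<longleftrightarrow> ?diag \<and> ?loc")
proof -
  let ?X = "configs Q {..<n}" and ?U = "{..<n} - T"
  have restrict_eq: "restrict x S = restrict y S \<longleftrightarrow> (\<forall>i\<in>S. x i = y i)"
    for x y :: config and S
    by (auto simp: restrict_def fun_eq_iff)
  have tensor: "op_tensor T ?U A op_id x y =
      (if \<forall>i\<in>?U. x i = y i then A (restrict x T) (restrict y T) else 0)" for A x y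
    by (simp add: op_tensor_def op_id_def restrict_eq)
  show ?thesis
  proof (intro iffI conjI)
    assume "acts_within Q n T E"
    then obtain A where A: "\<And>x y. x \<in> ?X \<Longrightarrow> y \<in> ?X \<Longrightarrow>
        E x y = (if \<forall>i\<in>?U. x i = y i then A (restrict x T) (restrict y T) else 0)"
      unfolding acts_within_def tensor by blast
    show ?diag
      using A by metis
    show ?loc
    proof (intro ballI impI)
      fix x y x' y'
      assume X: "x \<in> ?X" "y \<in> ?X" "x' \<in> ?X" "y' \<in> ?X"
        and T: "\<forall>i\<in>T. x i = x' i \<and> y i = y' i" and U: "\<forall>i\<in>?U. x i = y i \<and> x' i = y' i"
      have "restrict x T = restrict x' T" "restrict y T = restrict y' T"
        using T by (simp_all add: restrict_eq)
      with A[OF X(1,2)] A[OF X(3,4)] U show "E x y = E x' y'" by simp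
    qed
  next
    assume dl: "?diag \<and> ?loc"
    note diag = dl[THEN conjunct1, rule_format] and loc = dl[THEN conjunct2, rule_format]
    \<comment> \<open>\<open>A\<close> is rebuilt from \<open>E\<close> by picking any pair of full
      configurations that extends \<open>s\<close> and \<open>t\<close> and agrees off
      \<open>T\<close>; the second condition makes the entry independent of the pick.\<close>
    define ext where "ext s t p \<longleftrightarrow> fst p \<in> ?X \<and> snd p \<in> ?X \<and> restrict (fst p) T = s \<and>
        restrict (snd p) T = t \<and> (\<forall>i\<in>?U. fst p i = snd p i)" for s t p
    define A where "A s t = (let p = SOME p. ext s t p in E (fst p) (snd p))" for s t
    have "E x y = op_tensor T ?U A op_id x y" if X: "x \<in> ?X" "y \<in> ?X" for x y
    proof (cases "\<forall>i\<in>?U. x i = y i")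
      case True
      define p where "p = (SOME p. ext (restrict x T) (restrict y T) p)"
      have "ext (restrict x T) (restrict y T) (x, y)"
        using X True by (simp add: ext_def)
      then have "ext (restrict x T) (restrict y T) p"
        unfolding p_def by (rule someI)
      then have "E x y = E (fst p) (snd p)"
        using X True by (intro loc) (auto simp: ext_def restrict_eq)
      then show ?thesis
        using True by (simp add: tensor A_def p_def Let_def)
    next
      case False
      then show ?thesis using diag[OF X] by (simp add: tensor) blast
    qed
    then show "acts_within Q n T E"
      unfolding acts_within_def by blast
  qed
qed

text \<open>Ensures that the \<open>LEAST\<close> in \<open>wgt\<close> ranges over a nonempty set,
  so that the minimum is attained.\<close>

lemma acts_within_all: "acts_within Q n {..<n} E"
proof -
  have "E x y = E x' y'"
    if "x \<in> configs Q {..<n}" "y \<in> configs Q {..<n}" "x' \<in> configs Q {..<n}"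
      "y' \<in> configs Q {..<n}" "\<forall>i\<in>{..<n}. x i = x' i \<and> y i = y' i" for x y x' y'
    using configs_eqI[OF that(1,3)] configs_eqI[OF that(2,4)] that(5) by metis
  then show ?thesis unfolding acts_within_iff by blast
qed

lemma wgt_attained: "\<exists>T\<subseteq>{..<n}. card T = wgt Q n E \<and> acts_within Q n T E"
  unfolding wgt_def by (rule LeastI_ex) (use acts_within_all in blast)

lemma wgt_le: "T \<subseteq> {..<n} \<Longrightarrow> acts_within Q n T E \<Longrightarrow> wgt Q n E \<le> card T"
  unfolding wgt_def by (rule Least_le) blast

section \<open>Regrouping the computational basis into blocks\<close>

lemma div_less_blocks: "k < m * n \<Longrightarrow> k div m < n" for k m n :: nat
  by (simp add: less_mult_imp_div_less mult.commute)

lemma block_index_less: "i < n \<Longrightarrow> j < m \<Longrightarrow> m * i + j < m * n" for i j m n :: nat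
proof -
  assume "i < n" "j < m"
  then have "m * i + j < m * Suc i" by simp
  also have "\<dots> \<le> m * n" using \<open>i < n\<close> by (intro mult_le_mono2) simp
  finally show ?thesis .
qed

text \<open>\<open>enc\<close> is an arbitrary labelling of the basis states of one block by the
  levels of a single large subsystem; its bijectivity forces \<open>Q = q ^ m\<close>.\<close>

locale block_encoding =
  fixes q m n Q :: nat and enc :: "config \<Rightarrow> nat"
  assumes enc: "bij_betw enc (configs q {..<m}) {..<Q}"
begin

abbreviation "fine \<equiv> configs q {..<m * n}"
abbreviation "coarse \<equiv> configs Q {..<n}"

text \<open>Position \<open>k\<close> lies in block \<open>k div m\<close> at offset
  \<open>k mod m\<close>.\<close>

definition regroup :: "config \<Rightarrow> config" where
  "regroup x = (\<lambda>i\<in>{..<n}. enc (\<lambda>j\<in>{..<m}. x (m * i + j)))"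

definition split :: "config \<Rightarrow> config" where
  "split = the_inv_into fine regroup"

lemma block_in_configs:
  assumes "x \<in> fine" "i < n"
  shows "(\<lambda>j\<in>{..<m}. x (m * i + j)) \<in> configs q {..<m}"
  using assms block_index_less by (fastforce simp: configs_def)

lemma regroup_in: "x \<in> fine \<Longrightarrow> regroup x \<in> coarse"
  using block_in_configs bij_betwE[OF enc]
  by (auto simp: regroup_def configs_def[of Q])

text \<open>Locality: a block label reads only the positions of its block. For
  \<open>i \<ge> n\<close> both sides are \<open>undefined\<close>.\<close>

lemma regroup_cong:
  assumes "\<And>k. k < m * n \<Longrightarrow> k div m = i \<Longrightarrow> x k = y k"
  shows "regroup x i = regroup y i"
proof (cases "i < n")
  case True
  then have "(\<lambda>j\<in>{..<m}. x (m * i + j)) = (\<lambda>j\<in>{..<m}. y (m * i + j))"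
    using assms block_index_less by (intro restrict_ext) auto
  then show ?thesis by (simp add: regroup_def)
qed (simp add: regroup_def)

text \<open>Injectivity of \<open>enc\<close> lets one block label determine every position of its
  block, whatever the other blocks hold.\<close>

lemma regroup_eqD:
  assumes "x \<in> fine" "y \<in> fine" "k < m * n" "regroup x (k div m) = regroup y (k div m)"
  shows "x k = y k"
proof -
  have i: "k div m < n" using assms by (simp add: div_less_blocks)
  have m: "m > 0" using assms by (cases m) auto
  have "enc (\<lambda>j\<in>{..<m}. x (m * (k div m) + j)) = enc (\<lambda>j\<in>{..<m}. y (m * (k div m) + j))"
    using assms i by (simp add: regroup_def)
  then have "(\<lambda>j\<in>{..<m}. x (m * (k div m) + j)) = (\<lambda>j\<in>{..<m}. y (m * (k div m) + j))"
    using assms i block_in_configs bij_betw_imp_inj_on[OF enc] by (auto dest: inj_onD)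
  from fun_cong[OF this, of "k mod m"] m show ?thesis by simp
qed

text \<open>Injectivity holds block by block; surjectivity then follows by counting, as both sides
  have \<open>q ^ (m * n)\<close> elements.\<close>

lemma bij_regroup: "bij_betw regroup fine coarse"
proof -
  have inj: "inj_on regroup fine"
  proof (rule inj_onI)
    fix x y assume xy: "x \<in> fine" "y \<in> fine" "regroup x = regroup y"
    show "x = y"
      by (rule configs_eqI[OF xy(1,2)]) (simp add: regroup_eqD[OF xy(1,2)] xy(3))
  qed
  have "Q = q ^ m"
    using bij_betw_same_card[OF enc] by (simp add: card_configs)
  then have "card (regroup ` fine) = card coarse"
    using inj by (simp add: card_image card_configs power_mult)
  then have "regroup ` fine = coarse"
    using regroup_in by (intro card_subset_eq) (auto simp: finite_configs)
  with inj show ?thesis by (simp add: bij_betw_def)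
qed

lemma bij_split: "bij_betw split coarse fine"
  unfolding split_def by (rule bij_betw_the_inv_into[OF bij_regroup])

lemma split_in: "a \<in> coarse \<Longrightarrow> split a \<in> fine"
  using bij_betwE[OF bij_split] by blast

lemma regroup_split: "a \<in> coarse \<Longrightarrow> regroup (split a) = a"
  unfolding split_def by (rule f_the_inv_into_f_bij_betw[OF bij_regroup])

lemma sum_split: "(\<Sum>x\<in>fine. g x) = (\<Sum>a\<in>coarse. g (split a))"
  by (rule sum.reindex_bij_betw[OF bij_split, symmetric])

lemma split_eqD:
  assumes "a \<in> coarse" "b \<in> coarse" "k < m * n" "a (k div m) = b (k div m)"
  shows "split a k = split b k"
  by (rule regroup_eqD[OF split_in[OF assms(1)] split_in[OF assms(2)] assms(3)])
    (simp add: assms regroup_split)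

lemma split_eqI:
  assumes "a \<in> coarse" "b \<in> coarse" "\<And>k. k < m * n \<Longrightarrow> k div m = i \<Longrightarrow> split a k = split b k"
  shows "a i = b i"
  using regroup_cong[of i "split a" "split b"] assms by (simp add: regroup_split)

section \<open>Transport of states and operators along the relabelling\<close>

definition lift_state :: "state \<Rightarrow> state" where
  "lift_state \<psi> = (\<lambda>x. if x \<in> fine then \<psi> (regroup x) else 0)"

text \<open>Conjugation by the unitary \<open>lift_state\<close>. Operators travel from fine to
  coarse, opposite to states, because the conditions to be proved quantify over fine
  operators.\<close>

definition regroup_op :: "oper \<Rightarrow> oper" where
  "regroup_op E = (\<lambda>a b. E (split a) (split b))"

lemma linear_lift_state: "Vector_Spaces.linear scale_state scale_state lift_state"
  unfolding Vector_Spaces.linear_iff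
  by (auto simp: lift_state_def scale_state_def fun_eq_iff state.vector_space_axioms)

lemma lift_state_split: "a \<in> coarse \<Longrightarrow> lift_state \<psi> (split a) = \<psi> a"
  by (simp add: lift_state_def split_in regroup_split)

lemma lift_state_in: "lift_state \<psi> \<in> state_space q (m * n)"
  by (simp add: state_space_def lift_state_def)

lemma inj_on_lift_state: "inj_on lift_state (state_space Q n)"
proof (rule inj_onI)
  fix \<phi> \<psi> assume "\<phi> \<in> state_space Q n" "\<psi> \<in> state_space Q n" "lift_state \<phi> = lift_state \<psi>"
  then have "\<phi> a = \<psi> a" for a
    by (cases "a \<in> coarse") (auto simp: state_space_def simp flip: lift_state_split)
  then show "\<phi> = \<psi>" ..
qed

lemma braket_lift: "braket q (m * n) (lift_state \<phi>) (lift_state \<psi>) = braket Q n \<phi> \<psi>"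
  by (simp add: braket_def sum_split lift_state_split)

lemma op_apply_lift:
  "op_apply q (m * n) E (lift_state \<psi>) = lift_state (op_apply Q n (regroup_op E) \<psi>)"
proof
  fix x
  show "op_apply q (m * n) E (lift_state \<psi>) x = lift_state (op_apply Q n (regroup_op E) \<psi>) x"
  proof (cases "x \<in> fine")
    case True
    then have "split (regroup x) = x"
      unfolding split_def using bij_betw_imp_inj_on[OF bij_regroup]
      by (intro the_inv_into_f_f)
    with True show ?thesis
      by (simp add: op_apply_def lift_state_def regroup_in sum_split split_in regroup_split
          regroup_op_def)
  qed (simp add: op_apply_def lift_state_def)
qed

text \<open>Conjugation by a unitary respects products and adjoints, so the regrouped operator again
  has the form to which the coarse code's conditions apply.\<close>

lemma op_mult_regroup:
  "op_mult Q n (op_adjoint (regroup_op E)) (regroup_op F) =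
     regroup_op (op_mult q (m * n) (op_adjoint E) F)"
  by (simp add: op_mult_def op_adjoint_def regroup_op_def sum_split)

section \<open>Supports and weights under regrouping\<close>

lemma acts_within_regroup:
  assumes E: "acts_within q (m * n) T E"
  shows "acts_within Q n ((\<lambda>k. k div m) ` T) (regroup_op E)"
proof -
  let ?T = "(\<lambda>k. k div m) ` T"
  note diag = conjunct1[OF E[unfolded acts_within_iff], rule_format]
  note loc = conjunct2[OF E[unfolded acts_within_iff], rule_format]
  have same: "E (split a) (split b) = E (split a') (split b')"
    if mem: "a \<in> coarse" "b \<in> coarse" "a' \<in> coarse" "b' \<in> coarse"
      and T: "\<forall>i\<in>?T. a i = a' i \<and> b i = b' i" and U: "\<forall>i\<in>{..<n} - ?T. a i = b i \<and> a' i = b' i"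
    for a b a' b'
  proof -
    \<comment> \<open>The configurations on a block meeting \<open>T\<close> may still differ off \<open>T\<close>, but they do so
      simultaneously, in which case both matrix entries vanish.\<close>
    have iff: "split a k = split b k \<longleftrightarrow> split a' k = split b' k" if k: "k < m * n" for k
    proof (cases "k div m \<in> ?T")
      case True
      then have "split a k = split a' k" "split b k = split b' k"
        using T[rule_format, OF True] split_eqD[OF mem(1,3) k] split_eqD[OF mem(2,4) k] by auto
      then show ?thesis by simp
    next
      case False
      then have "a (k div m) = b (k div m)" "a' (k div m) = b' (k div m)"
        using U div_less_blocks[OF k] by auto
      then show ?thesis by (simp add: split_eqD[OF mem(1,2) k] split_eqD[OF mem(3,4) k])
    qed
    show ?thesis
    proof (cases "\<forall>k\<in>{..<m * n} - T. split a k = split b k")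
      case True
      have agree: "split c k = split c' k"
        if "k \<in> T" and c: "c \<in> coarse" "c' \<in> coarse" "\<forall>i\<in>?T. c i = c' i" for c c' k
      proof (cases "k < m * n")
        case True
        then show ?thesis using \<open>k \<in> T\<close> c(3) by (intro split_eqD[OF c(1,2)]) auto
      next
        \<comment> \<open>\<open>T\<close> may contain indices beyond \<open>m * n\<close>; there
          both configurations are \<open>undefined\<close>.\<close>
        case False
        then show ?thesis using split_in[OF c(1)] split_in[OF c(2)]
            by (auto simp: configs_def PiE_def extensional_def)
      qed
      show ?thesis
        using True iff mem T by (intro loc) (auto simp: split_in intro: agree)
    next
      case False
      then obtain k where "k \<in> {..<m * n} - T" "split a k \<noteq> split b k" "split a' k \<noteq> split b' k"
        using iff by blast
      then show ?thesis using diag mem split_in by metis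
    qed
  qed
  \<comment> \<open>All positions of a block that misses \<open>T\<close> lie off \<open>T\<close>,
    so a nonzero entry forces agreement on the whole block.\<close>
  have "a i = b i"
    if "a \<in> coarse" "b \<in> coarse" "E (split a) (split b) \<noteq> 0" "i \<in> {..<n} - ?T" for a b i
    by (rule split_eqI[OF that(1,2)], rule diag[OF split_in[OF that(1)] split_in[OF that(2)] that(3)])
      (use that(4) in auto)
  with same show ?thesis
    unfolding acts_within_iff regroup_op_def by blast
qed

lemma wgt_regroup_le: "wgt Q n (regroup_op E) \<le> wgt q (m * n) E"
proof -
  obtain T where T: "T \<subseteq> {..<m * n}" "card T = wgt q (m * n) E" "acts_within q (m * n) T E"
    using wgt_attained by blast
  have "wgt Q n (regroup_op E) \<le> card ((\<lambda>k. k div m) ` T)"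
    using T by (intro wgt_le acts_within_regroup) (auto simp: div_less_blocks)
  also have "\<dots> \<le> card T"
    using T by (intro card_image_le) (auto intro: finite_subset)
  finally show ?thesis using T by simp
qed

section \<open>Transport of the code\<close>

lemma dim_lift_state:
  assumes C: "state.subspace C" "C \<subseteq> state_space Q n"
  shows "state.dim (lift_state ` C) = state.dim C"
proof -
  interpret lift: Vector_Spaces.linear scale_state scale_state lift_state
    by (rule linear_lift_state)
  obtain B where B: "B \<subseteq> C" "state.independent B" "C \<subseteq> state.span B" "card B = state.dim C"
    by (rule state.basis_exists)
  have span: "state.span B = C"
    using B C by (simp add: state.span_subspace)
  have inj: "inj_on lift_state C"
    using C inj_on_lift_state inj_on_subset by blast
  \<comment> \<open>\<open>lift_state\<close> forgets values off \<open>coarse\<close>, so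
    injectivity is available on the span of \<open>B\<close>, which is \<open>C\<close>, but not on
    all functions.\<close>
  have "state.independent (lift_state ` B)"
    using B inj span by (intro lift.independent_injective_image) auto
  moreover have "state.span (lift_state ` B) = lift_state ` C"
    by (simp add: lift.span_image span)
  ultimately have "state.dim (lift_state ` C) = card (lift_state ` B)"
    by (metis state.dim_span_eq_card_independent)
  also have "\<dots> = card B"
    using B(1) inj by (intro card_image) (rule inj_on_subset)
  finally show ?thesis using B by simp
qed

lemma knill_laflamme_lift:
  assumes "knill_laflamme Q n B (regroup_op E)"
  shows "knill_laflamme q (m * n) (lift_state ` B) E"
  using assms unfolding knill_laflamme_def ball_simps op_apply_lift braket_lift by metis

lemma orthonormal_basis_lift:
  assumes "orthonormal_basis Q n B C" and C: "C \<subseteq> state_space Q n"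
  shows "orthonormal_basis q (m * n) (lift_state ` B) (lift_state ` C)"
proof -
  interpret lift: Vector_Spaces.linear scale_state scale_state lift_state
    by (rule linear_lift_state)
  have "B \<subseteq> C"
    using assms state.span_superset[of B] by (simp add: orthonormal_basis_def)
  \<comment> \<open>Two distinct basis vectors with the same image would violate the norm condition,
    since their inner product is 0.\<close>
  then have "inj_on lift_state B"
    using C inj_on_lift_state by (meson inj_on_subset)
  then show ?thesis
    using assms by (auto simp: orthonormal_basis_def lift.span_image braket_lift dest: inj_onD)
qed

lemma is_qecc_lift:
  assumes "is_qecc n K d Q C"
  shows "is_qecc (m * n) K d q (lift_state ` C)"
proof -
  interpret lift: Vector_Spaces.linear scale_state scale_state lift_state
    by (rule linear_lift_state)
  have C: "state.subspace C" "C \<subseteq> state_space Q n" "state.dim C = K" "K > 1"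
    using assms by (auto simp: is_qecc_def)
  obtain B where B: "orthonormal_basis Q n B C"
    and KL: "\<And>Ek El. wgt Q n (op_mult Q n (op_adjoint Ek) El) < d \<Longrightarrow>
       knill_laflamme Q n B (op_mult Q n (op_adjoint Ek) El)"
    using assms by (auto simp: is_qecc_def)
  have "knill_laflamme q (m * n) (lift_state ` B) (op_mult q (m * n) (op_adjoint Ek) El)"
    if "wgt q (m * n) (op_mult q (m * n) (op_adjoint Ek) El) < d" for Ek El
    \<comment> \<open>The coarse conditions are used for the regrouped pair, whose product still has
      weight below \<open>d\<close>.\<close>
    using KL[of "regroup_op Ek" "regroup_op El"] that wgt_regroup_le
    by (intro knill_laflamme_lift) (metis le_less_trans op_mult_regroup)
  moreover have "orthonormal_basis q (m * n) (lift_state ` B) (lift_state ` C)"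
    using B C by (intro orthonormal_basis_lift)
  ultimately show ?thesis
    unfolding is_qecc_def
    using C dim_lift_state lift.subspace_image lift_state_in by blast
qed

end

theorem theorem4p3:
  fixes q m n K d :: nat
  assumes "q \<ge> 2" and "m \<ge> 1"
    and "\<exists>C. is_qecc n K d (q ^ m) C"
  shows "\<exists>d'\<ge>d. \<exists>C'. is_qecc (m * n) K d' q C'"
proof -
  obtain C where "is_qecc n K d (q ^ m) C"
    using assms by blast
  \<comment> \<open>Both sets have \<open>q ^ m\<close> elements, so some labelling exists.\<close>
  moreover obtain enc where "bij_betw enc (configs q {..<m}) {..<q ^ m}"
    using finite_same_card_bij[of "configs q {..<m}" "{..<q ^ m}"]
    by (auto simp: finite_configs card_configs)
  \<comment> \<open>The witness for \<open>d'\<close> is \<open>d\<close> itself.\<close>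
  ultimately show ?thesis
    using block_encoding.is_qecc_lift[OF block_encoding.intro] by blast
qed

end
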